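(* Let $\mathbb{F}$ be a field and let $A=\otimes_{i=1}^{\infty}A_i$ be a countable-dimensional unital locally matrix algebra, where $A_i\cong M_{n_i}(\mathbb{F})$, $i\ge1$. For each $n\ge1$ let $H_n$ be the subgroup of $\mathrm{Inn}(A)$ generated by conjugations by invertible elements from $\otimes_{i\ge n}A_i$, and let $\mathcal{X}_n$ be a system of representatives of the left cosets $hH_{n+1}$, $h\in H_n$, which contains the identical automorphism. Then an arbitrary unital injective endomorphism $\varphi\in P(A)$ can be uniquely represented as $$\varphi=\varphi_1\varphi_2\cdots,$$ where $\varphi_i\in\mathcal{X}_i$ for each $i\ge1$.
   Context: An associative $\mathbb{F}$-algebra $A$ is a locally matrix algebra if every finite subset of $A$ is contained in a subalgebra $B\subset A$ with $B\cong M_n(\mathbb{F})$ for some $n$; it is unital if it has a unit $1$. Countable-dimensional means of dimension $\aleph_0$ over $\mathbb{F}$. By a theorem of Koethe every countable-dimensional unital locally matrix algebra is isomorphic to a countable tensor product of matrix algebras. The infinite tensor product $\otimes_{i=1}^\infty A_i$ is the direct limit of the finite tensor products $A_1\otimes\cdots\otimes A_m$ (embedded via $x\mapsto x\otimes1$); $\otimes_{i\ge n}A_i$ is regarded as a subalgebra of $A$ by filling in units in positions $1,\dots,n-1$. $\mathrm{Inn}(A)$ is the group of inner automorphisms $x\mapsto a^{-1}xa$, $a\in A$ invertible. $P(A)$ is the semigroup of injective $\mathbb{F}$-algebra endomorphisms $\varphi$ of $A$ with $\varphi(1)=1$. One has $\mathrm{Inn}(A)=H_1>H_2>\cdots$.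 For a sequence $\varphi_n\in H_n$, $n\ge1$, the infinite product $\varphi_1\varphi_2\cdots$ is the limit of the compositions $\varphi_1\varphi_2\cdots\varphi_m=\varphi_1\circ\varphi_2\circ\cdots\circ\varphi_m$ in the Tykhonoff topology (pointwise convergence with $A$ discrete): for $a\in A_1\otimes\cdots\otimes A_k$, its value at $a$ is $\varphi_1\cdots\varphi_m(a)$ for all $m\ge k$ (this is independent of $m\ge k$, since every element of $H_n$ fixes $A_1\otimes\cdots\otimes A_{n-1}$ elementwise). This limit lies in $P(A)$. *)

theory Defs
  imports
    "HOL-Library.Poly_Mapping"
    "HOL-Algebra.Generated_Groups"
    "HOL-Analysis.Function_Topology"
    "HOL-Analysis.Abstract_Limits"
    "Jordan_Normal_Form.Matrix"
begin

section \<open>Unital algebras over a field\<close>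

locale unital_algebra = vector_space scale
  for scale :: "'f::field \<Rightarrow> 'a::ring_1 \<Rightarrow> 'a" (infixr \<open>*s\<close> 75) +
  assumes scale_mult_left: "(c *s x) * y = c *s (x * y)"
    and scale_mult_right: "x * (c *s y) = c *s (x * y)"
begin

definition subalgebra :: "'a set \<Rightarrow> bool" where
  "subalgebra B \<longleftrightarrow> subspace B \<and> (\<forall>x\<in>B. \<forall>y\<in>B. x * y \<in> B)"

text \<open>The unit of \<open>B\<close> is not required to be the unit of the ambient algebra.\<close>

definition matrix_subalgebra :: "nat \<Rightarrow> 'a set \<Rightarrow> bool" where
  "matrix_subalgebra n B \<longleftrightarrow> 0 < n \<and> subalgebra B \<and>
     (\<exists>g :: 'a \<Rightarrow> 'f mat. bij_betw g B (carrier_mat n n) \<and>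
        (\<forall>x\<in>B. \<forall>y\<in>B. g (x + y) = g x + g y) \<and>
        (\<forall>x\<in>B. \<forall>y\<in>B. g (x * y) = g x * g y) \<and>
        (\<forall>c. \<forall>x\<in>B. g (c *s x) = c \<cdot>\<^sub>m g x))"

definition locally_matrix :: bool where
  "locally_matrix \<longleftrightarrow> (\<forall>S. finite S \<longrightarrow> (\<exists>n B. S \<subseteq> B \<and> matrix_subalgebra n B))"

definition countable_dimensional :: bool where
  "countable_dimensional \<longleftrightarrow>
     (\<exists>B. independent B \<and> span B = UNIV \<and> countable B \<and> infinite B)"

text \<open>The semigroup $P(A)$.\<close>

definition unital_injective_endos :: "('a \<Rightarrow> 'a) set" where
  "unital_injective_endos = {\<phi>. Vector_Spaces.linear scale scale \<phi> \<and>
     (\<forall>x y. \<phi> (x * y) = \<phi> x * \<phi> y) \<and> \<phi> 1 = 1 \<and> inj \<phi>}"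

end


section \<open>Infinite tensor products\<close>

text \<open>
  Factors are indexed from 0. They are identified with their images in the tensor product, so a
  family of factors is a family of subsets \<open>A i\<close> of the ambient algebra. A list
  $[x_0, \dots, x_{m-1}]$ with \<open>x\<^sub>i \<in> A i\<close> stands for the generator
  $x_0 \otimes \cdots \otimes x_{m-1}$.
\<close>

definition tuples :: "(nat \<Rightarrow> 'a set) \<Rightarrow> nat \<Rightarrow> 'a list set" where
  "tuples A m = {xs. length xs = m \<and> (\<forall>i<m. xs ! i \<in> A i)}"

text \<open>The free vector space on the tuples, inside all finitely supported functions on lists.\<close>

definition free_tuples :: "(nat \<Rightarrow> 'a set) \<Rightarrow> nat \<Rightarrow> ('a list \<Rightarrow>\<^sub>0 'f::field) set" where
  "free_tuples A m = {p. Poly_Mapping.keys p \<subseteq> tuples A m}"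

definition scale_free :: "'f::field \<Rightarrow> ('b \<Rightarrow>\<^sub>0 'f) \<Rightarrow> ('b \<Rightarrow>\<^sub>0 'f)" where
  "scale_free c p = Poly_Mapping.map ((*) c) p"

context unital_algebra
begin

text \<open>
  The subspace spanned by the multilinearity relations. The vector space
  $A_0 \otimes \cdots \otimes A_{m-1}$ is \<open>free_tuples A m\<close> modulo \<open>tensor_relations A m\<close>.
\<close>

definition tensor_relations :: "(nat \<Rightarrow> 'a set) \<Rightarrow> nat \<Rightarrow> ('a list \<Rightarrow>\<^sub>0 'f) set" where
  "tensor_relations A m = Modules.module.span scale_free
     ({Poly_Mapping.single (xs[i := x + y]) 1 - Poly_Mapping.single (xs[i := x]) 1
         - Poly_Mapping.single (xs[i := y]) 1 |xs i x y.
         xs \<in> tuples A m \<and> i < m \<and> x \<in> A i \<and> y \<in> A i} \<union>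
      {Poly_Mapping.single (xs[i := c *s x]) 1
         - scale_free c (Poly_Mapping.single (xs[i := x]) 1) |xs i c x.
         xs \<in> tuples A m \<and> i < m \<and> x \<in> A i})"

text \<open>The linear extension of $x_0 \otimes \cdots \otimes x_{m-1} \mapsto x_0 \cdots x_{m-1}$.\<close>

definition tensor_eval :: "('a list \<Rightarrow>\<^sub>0 'f) \<Rightarrow> 'a" where
  "tensor_eval p = (\<Sum>xs\<in>Poly_Mapping.keys p. Poly_Mapping.lookup p xs *s prod_list xs)"

text \<open>
  The ambient algebra is the direct limit of the algebras $A_0 \otimes \cdots \otimes A_{m-1}$ along
  $x \mapsto x \otimes 1$: as the factors commute, multiplication induces compatible algebra
  homomorphisms from them to the ambient algebra. The third condition says that these are injective
  (their kernels in the free spaces are exactly the relations), the last one that their images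
  exhaust the algebra.
\<close>

definition infinite_tensor_product :: "(nat \<Rightarrow> 'a set) \<Rightarrow> bool" where
  "infinite_tensor_product A \<longleftrightarrow>
     (\<forall>i. subalgebra (A i) \<and> 1 \<in> A i) \<and>
     (\<forall>i j. i \<noteq> j \<longrightarrow> (\<forall>x\<in>A i. \<forall>y\<in>A j. x * y = y * x)) \<and>
     (\<forall>m. {p \<in> free_tuples A m. tensor_eval p = 0} = tensor_relations A m) \<and>
     (\<Union>m. tensor_eval ` free_tuples A m) = UNIV"

text \<open>
  The tail $\bigotimes_{i \ge n} A_i$, embedded by filling in units in the positions below \<open>n\<close>.
\<close>

definition tensor_tail :: "(nat \<Rightarrow> 'a set) \<Rightarrow> nat \<Rightarrow> 'a set" where
  "tensor_tail A n =
     span (prod_list ` {xs. \<exists>m. xs \<in> tuples A m \<and> (\<forall>i<m. i < n \<longrightarrow> xs ! i = 1)})"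

end


section \<open>Inner automorphisms\<close>

text \<open>Conjugations $x \mapsto a^{-1} x a$ by the invertible elements \<open>a\<close> (of the whole ring)
  lying in \<open>S\<close>.\<close>

definition conjugations :: "'a::ring_1 set \<Rightarrow> ('a \<Rightarrow> 'a) set" where
  "conjugations S = {(\<lambda>x. b * x * a) |a b. a \<in> S \<and> a * b = 1 \<and> b * a = 1}"

definition Inn :: "('a::ring_1 \<Rightarrow> 'a) monoid" where
  "Inn = \<lparr>carrier = conjugations UNIV, monoid.mult = (\<circ>), one = id\<rparr>"

definition (in unital_algebra) H :: "(nat \<Rightarrow> 'a set) \<Rightarrow> nat \<Rightarrow> ('a \<Rightarrow> 'a) set" where
  "H A n = generate Inn (conjugations (tensor_tail A n))"

text \<open>\<open>X\<close> represents the left cosets \<open>h K\<close> with \<open>h \<in> L\<close>.\<close>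

definition left_coset_representatives ::
    "('g, 'm) monoid_scheme \<Rightarrow> 'g set \<Rightarrow> 'g set \<Rightarrow> 'g set \<Rightarrow> bool" where
  "left_coset_representatives G L K X \<longleftrightarrow>
     X \<subseteq> L \<and> (\<forall>h\<in>L. \<exists>!x. x \<in> X \<and> x \<in> h <#\<^bsub>G\<^esub> K)"


section \<open>Infinite products of maps\<close>

definition partial_composition :: "(nat \<Rightarrow> 'a \<Rightarrow> 'a) \<Rightarrow> nat \<Rightarrow> 'a \<Rightarrow> 'a" where
  "partial_composition f m = foldr (\<circ>) (map f [0..<m]) id"

definition has_infinite_product :: "(nat \<Rightarrow> 'a \<Rightarrow> 'a) \<Rightarrow> ('a \<Rightarrow> 'a) \<Rightarrow> bool" where
  "has_infinite_product f g \<longleftrightarrow>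
     limitin (product_topology (\<lambda>_. discrete_topology UNIV) UNIV)
       (partial_composition f) g sequentially"

end

theory Submission
  imports Defs "Jordan_Normal_Form.Determinant"
begin

text \<open>
  Two facts about the algebra carry the theorem.

  First, every \<open>\<phi> \<in> P(A)\<close> agrees on each matrix subalgebra containing the unit with an inner
  automorphism of the whole algebra (\<open>endo_agrees_with_inner\<close>, a form of the Skolem--Noether
  theorem).
  The matrix units of the subalgebra and their images under \<open>\<phi>\<close> lie in one larger matrix subalgebra,
  so it is enough to conjugate two systems of \<open>n \<times> n\<close> matrix units with sum \<open>1\<close> inside
  $M_N(\mathbb{F})$. A conjugating element is obtained by transporting an equivalence of the two
  corner idempotents to all diagonal positions. Traces cannot be used to show that the corners have
  the same rank, because the characteristic is arbitrary. Instead, any two idempotents of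
  $M_N(\mathbb{F})$ are comparable (\<open>idempotents_comparable\<close>). Transporting a comparison of the
  corners gives an element with a one-sided inverse, and one-sided inverses in
  $M_N(\mathbb{F})$ are two-sided.

  Second, the tail \<open>tensor_tail A n\<close> is the centralizer of the factors \<open>A i\<close> with \<open>i < n\<close>
  (\<open>tensor_tail_iff_commute\<close>). Hence \<open>H A n\<close> consists of all inner automorphisms that fix
  these factors elementwise (\<open>H_eq\<close>). In this description no generation is involved, and two
  elements of \<open>H A n\<close> lie in the same left coset of \<open>H A (Suc n)\<close> exactly when they agree on
  \<open>A n\<close>.

  Both halves of the theorem now follow by working along the factors. Suppose that the product
  $c = \psi_0 \cdots \psi_{m-1}$ agrees with \<open>\<phi>\<close> on the factors below \<open>m\<close>. Then
  $c^{-1}\varphi$ agrees with some inner \<open>h\<close> on the factors up to \<open>m\<close>. This \<open>h\<close> lies in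
  \<open>H A m\<close>, and the representative of its coset is a possible $\psi_m$. Conversely, all $\psi_j$
  with $j > m$ fix \<open>A m\<close>, so \<open>\<phi>\<close> and $\psi_0, \dots, \psi_{m-1}$ determine the values of
  $\psi_m$ on the factors up to \<open>m\<close>, hence its coset, hence $\psi_m$.
\<close>

section \<open>Matrix units\<close>

context unital_algebra
begin

text \<open>
  Only spanning is demanded, since linear independence follows from the multiplication rule
  and $1 \neq 0$. The unit is that of the ambient algebra.
\<close>

definition matrix_units :: "nat \<Rightarrow> (nat \<Rightarrow> nat \<Rightarrow> 'a) \<Rightarrow> 'a set \<Rightarrow> bool" where
  "matrix_units n e B \<longleftrightarrow>
     (\<forall>i<n. \<forall>j<n. e i j \<in> B) \<and>
     (\<forall>i<n. \<forall>j<n. \<forall>k<n. \<forall>l<n. e i j * e k l = (if j = k then e i l else 0)) \<and>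
     (\<Sum>i<n. e i i) = 1 \<and>
     (\<forall>x\<in>B. \<exists>c. x = (\<Sum>i<n. \<Sum>j<n. c i j *s e i j))"

lemma matrix_unitsD:
  assumes "matrix_units n e B"
  shows "i < n \<Longrightarrow> j < n \<Longrightarrow> e i j \<in> B"
    and "i < n \<Longrightarrow> j < n \<Longrightarrow> k < n \<Longrightarrow> l < n \<Longrightarrow> e i j * e k l = (if j = k then e i l else 0)"
    and "(\<Sum>i<n. e i i) = 1"
    and "x \<in> B \<Longrightarrow> \<exists>c. x = (\<Sum>i<n. \<Sum>j<n. c i j *s e i j)"
    and "0 < n"
  using assms unfolding matrix_units_def by (auto intro: gr0I)

lemma subalgebra_closed:
  assumes "subalgebra B"
  shows "0 \<in> B" "x \<in> B \<Longrightarrow> y \<in> B \<Longrightarrow> x + y \<in> B" "x \<in> B \<Longrightarrow> y \<in> B \<Longrightarrow> x - y \<in> B"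
    "x \<in> B \<Longrightarrow> y \<in> B \<Longrightarrow> x * y \<in> B" "x \<in> B \<Longrightarrow> c *s x \<in> B"
    "(\<And>i. i \<in> I \<Longrightarrow> f i \<in> B) \<Longrightarrow> sum f I \<in> B"
  using assms unfolding subalgebra_def
  by (auto intro: subspace_0 subspace_add subspace_diff subspace_scale subspace_sum)

lemma matrix_isomorphism_one:
  fixes g :: "'a \<Rightarrow> 'f mat"
  assumes g: "bij_betw g B (carrier_mat n n)" and one: "1 \<in> B"
    and mult: "\<And>x y. x \<in> B \<Longrightarrow> y \<in> B \<Longrightarrow> g (x * y) = g x * g y"
  shows "g 1 = 1\<^sub>m n"
proof -
  have "(1\<^sub>m n :: 'f mat) \<in> g ` B"
    using g by (simp add: bij_betw_def)
  then obtain u where u: "u \<in> B" "g u = 1\<^sub>m n"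
    by auto
  have "g 1 \<in> carrier_mat n n"
    using g one by (auto simp: bij_betw_def)
  then show ?thesis
    using mult[OF one u(1)] u(2) by simp
qed

lemma matrix_subalgebra_has_units:
  assumes B: "matrix_subalgebra n B" and one: "1 \<in> B"
  obtains e where "matrix_units n e B"
proof -
  obtain g :: "'a \<Rightarrow> 'f mat" where g: "bij_betw g B (carrier_mat n n)"
    and add: "\<And>x y. x \<in> B \<Longrightarrow> y \<in> B \<Longrightarrow> g (x + y) = g x + g y"
    and mult: "\<And>x y. x \<in> B \<Longrightarrow> y \<in> B \<Longrightarrow> g (x * y) = g x * g y"
    and scl: "\<And>c x. x \<in> B \<Longrightarrow> g (c *s x) = c \<cdot>\<^sub>m g x"
    and sub: "subalgebra B"
    using B unfolding matrix_subalgebra_def by blast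
  note closed = subalgebra_closed[OF sub]
  have carr: "g x \<in> carrier_mat n n" if "x \<in> B" for x
    using g that by (auto simp: bij_betw_def)
  have inj: "x = y" if "x \<in> B" "y \<in> B" "g x = g y" for x y
    using g that by (auto simp: bij_betw_def inj_on_def)
  have g1: "g 1 = 1\<^sub>m n"
    by (rule matrix_isomorphism_one[OF g one]) (rule mult)
  have g0: "g 0 = 0\<^sub>m n n"
  proof -
    have "g 0 = 0 \<cdot>\<^sub>m g 1"
      using scl[OF one, of 0] by simp
    then show ?thesis
      using carr[OF one] by auto
  qed
  have entry_sum: "g (sum f S) $$ (k, l) = (\<Sum>s\<in>S. g (f s) $$ (k, l))"
    if "k < n" "l < n" "finite S" "\<And>s. s \<in> S \<Longrightarrow> f s \<in> B" for k l S and f :: "nat \<Rightarrow> 'a"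
    using that(3,4)
  proof (induction S rule: finite_induct)
    case empty
    then show ?case using g0 that by simp
  next
    case (insert s S)
    have "sum f S \<in> B" "f s \<in> B"
      using insert by (auto intro: closed)
    then have "g (sum f (insert s S)) = g (f s) + g (sum f S)" "g (sum f S) \<in> carrier_mat n n"
      using insert add carr by auto
    then show ?case
      using insert that by simp
  qed
  define U :: "nat \<Rightarrow> nat \<Rightarrow> 'f mat" where
    "U i j = mat n n (\<lambda>(k, l). if k = i \<and> l = j then 1 else 0)" for i j
  define e where "e i j = inv_into B g (U i j)" for i j
  have U: "U i j \<in> g ` B" for i j
    using g by (simp add: bij_betw_def U_def)
  have e: "e i j \<in> B" "g (e i j) = U i j" for i j
    using U[of i j] by (auto simp: e_def inv_into_into f_inv_into_f)
  have U_mult: "U i j * U k l = (if j = k then U i l else 0\<^sub>m n n)" 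
    if "i < n" "j < n" "k < n" "l < n" for i j k l
  proof (rule eq_matI)
    fix p q assume "p < dim_row (if j = k then U i l else 0\<^sub>m n n)"
      and "q < dim_col (if j = k then U i l else 0\<^sub>m n n)"
    then have pq: "p < n" "q < n" by (auto simp: U_def split: if_splits)
    have "(U i j * U k l) $$ (p, q)
        = (\<Sum>r = 0..<n. (if p = i \<and> r = j then 1 else 0) * (if r = k \<and> q = l then 1 else 0))"
      using pq by (simp add: U_def scalar_prod_def)
    also have "\<dots> = (\<Sum>r = 0..<n. if r = j then (if p = i \<and> j = k \<and> q = l then 1 else 0) else 0)"
      by (rule sum.cong) auto
    also have "\<dots> = (if j = k then U i l else 0\<^sub>m n n) $$ (p, q)"
      using pq that by (simp add: U_def)
    finally show "(U i j * U k l) $$ (p, q) = (if j = k then U i l else 0\<^sub>m n n) $$ (p, q)" .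
  qed (auto simp: U_def)
  have "matrix_units n e B"
    unfolding matrix_units_def
  proof (intro conjI allI ballI impI)
    fix i j assume "i < n" "j < n"
    show "e i j \<in> B" by (rule e)
  next
    fix i j k l assume ijkl: "i < n" "j < n" "k < n" "l < n"
    show "e i j * e k l = (if j = k then e i l else 0)"
      using ijkl e by (intro inj) (auto simp: mult U_mult g0 intro: closed)
  next
    show "(\<Sum>i<n. e i i) = 1"
    proof (rule inj)
      show "g (\<Sum>i<n. e i i) = g 1"
        unfolding g1
      proof (rule eq_matI)
        fix k l assume "k < dim_row (1\<^sub>m n :: 'f mat)" "l < dim_col (1\<^sub>m n :: 'f mat)"
        then have kl: "k < n" "l < n" by auto
        have "g (\<Sum>i<n. e i i) $$ (k, l) = (\<Sum>i<n. g (e i i) $$ (k, l))"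
          using kl by (simp add: entry_sum e)
        also have "\<dots> = (\<Sum>i<n. if i = k then (if k = l then 1 else 0) else 0)"
          using kl by (intro sum.cong) (auto simp: e U_def)
        also have "\<dots> = 1\<^sub>m n $$ (k, l)"
          using kl by simp
        finally show "g (\<Sum>i<n. e i i) $$ (k, l) = 1\<^sub>m n $$ (k, l)" .
      qed (use carr[of "\<Sum>i<n. e i i"] in \<open>auto intro: closed e\<close>)
    qed (auto intro: closed e one)
  next
    fix x assume x: "x \<in> B"
    let ?y = "\<Sum>i<n. \<Sum>j<n. (g x $$ (i, j)) *s e i j"
    have y: "?y \<in> B" by (intro closed e)
    have "x = ?y"
    proof (rule inj[OF x y], rule eq_matI)
      fix k l assume "k < dim_row (g ?y)" "l < dim_col (g ?y)"
      then have kl: "k < n" "l < n" using carr[OF y] by auto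
      have "g ?y $$ (k, l) = (\<Sum>i<n. \<Sum>j<n. g ((g x $$ (i, j)) *s e i j) $$ (k, l))"
        using kl by (simp add: entry_sum closed e)
      also have "\<dots> = (\<Sum>i<n. \<Sum>j<n. if l = j then (if k = i then g x $$ (i, j) else 0) else 0)"
        using kl by (intro sum.cong) (auto simp: scl e U_def)
      also have "\<dots> = g x $$ (k, l)"
        using kl by simp
      finally show "g x $$ (k, l) = g ?y $$ (k, l)" by simp
    qed (use carr[OF x] carr[OF y] in auto)
    then show "\<exists>c. x = (\<Sum>i<n. \<Sum>j<n. c i j *s e i j)"
      by (rule exI[where x = "\<lambda>i j. g x $$ (i, j)"])
  qed
  then show thesis by (rule that)
qed

text \<open>
  One-sided inverses become two-sided here; this finiteness is what replaces a comparison of ranks.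
\<close>

lemma matrix_subalgebra_left_right_inverse:
  assumes B: "matrix_subalgebra n B" and one: "1 \<in> B"
    and x: "x \<in> B" and y: "y \<in> B" and xy: "x * y = 1"
  shows "y * x = 1"
proof -
  obtain g :: "'a \<Rightarrow> 'f mat" where g: "bij_betw g B (carrier_mat n n)"
    and mult: "\<And>x y. x \<in> B \<Longrightarrow> y \<in> B \<Longrightarrow> g (x * y) = g x * g y"
    and sub: "subalgebra B"
    using B unfolding matrix_subalgebra_def by blast
  have g1: "g 1 = 1\<^sub>m n"
    by (rule matrix_isomorphism_one[OF g one]) (rule mult)
  have carr: "g x \<in> carrier_mat n n" "g y \<in> carrier_mat n n"
    using g x y by (auto simp: bij_betw_def)
  have "g y * g x = 1\<^sub>m n"
    by (rule mat_mult_left_right_inverse[OF carr]) (simp add: g1 xy flip: mult[OF x y])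
  then have "g (y * x) = g 1"
    by (simp add: mult x y g1)
  then show ?thesis
    using g one subalgebra_closed(4)[OF sub y x] by (auto simp: bij_betw_def inj_on_def)
qed

text \<open>
  Sandwiching by matrix units reads off the coordinates of \<open>x\<close>.
\<close>

lemma matrix_units_corner:
  assumes e: "matrix_units n e B" and x: "x \<in> B"
  obtains c where "\<And>k i j l. k < n \<Longrightarrow> i < n \<Longrightarrow> j < n \<Longrightarrow> l < n \<Longrightarrow> e k i * x * e j l = c i j *s e k l"
    and "x = (\<Sum>i<n. \<Sum>j<n. c i j *s e i j)"
proof -
  obtain c where c: "x = (\<Sum>i<n. \<Sum>j<n. c i j *s e i j)"
    using matrix_unitsD(4)[OF e x] by blast
  have "e k i * x * e j l = c i j *s e k l" if l: "k < n" "i < n" "j < n" "l < n" for k i j l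
  proof -
    have "e k i * x * e j l = (\<Sum>p<n. \<Sum>q<n. c p q *s (e k i * e p q * e j l))"
      by (simp add: c sum_distrib_left sum_distrib_right scale_mult_left scale_mult_right)
    also have "\<dots> = (\<Sum>p<n. \<Sum>q<n. if q = j then (if p = i then c p q *s e k l else 0) else 0)"
      using l by (intro sum.cong) (auto simp: matrix_unitsD(2)[OF e])
    also have "\<dots> = c i j *s e k l"
      using l by simp
    finally show ?thesis .
  qed
  with c that show thesis by blast
qed

lemma matrix_unit_nonzero:
  assumes e: "matrix_units n e B" and l: "i < n" "j < n"
  shows "e i j \<noteq> 0"
proof
  assume 0: "e i j = 0"
  have "e k k = 0" if k: "k < n" for k
  proof -
    have "e k k = e k i * e i j * e j k"
      using k l by (simp add: matrix_unitsD(2)[OF e])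
    then show ?thesis by (simp add: 0)
  qed
  then have "(\<Sum>k<n. e k k) = 0" by simp
  then show False using matrix_unitsD(3)[OF e] by simp
qed

section \<open>Conjugacy of systems of matrix units\<close>

text \<open>
  Primeness and von Neumann regularity of a matrix algebra in one statement: between two nonzero
  elements \<open>x\<close> and \<open>y\<close> there is a nonzero \<open>z = x w y\<close> of rank one, and \<open>z t z = z\<close> for
  some \<open>t\<close>. For \<open>w\<close> one takes the matrix unit that connects a nonzero column of \<open>x\<close> with a
  nonzero row of \<open>y\<close>.
\<close>

lemma matrix_units_link:
  assumes e: "matrix_units n e B" and sub: "subalgebra B"
    and x: "x \<in> B" "x \<noteq> 0" and y: "y \<in> B" "y \<noteq> 0"
  obtains w t where "w \<in> B" "t \<in> B" "x * w * y \<noteq> 0" "x * w * y * t * x * w * y = x * w * y"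
proof -
  obtain c where c: "\<And>k i j l. k < n \<Longrightarrow> i < n \<Longrightarrow> j < n \<Longrightarrow> l < n \<Longrightarrow> e k i * x * e j l = c i j *s e k l"
    and cx: "x = (\<Sum>i<n. \<Sum>j<n. c i j *s e i j)"
    by (rule matrix_units_corner[OF e x(1)]) blast
  obtain d where d: "\<And>k i j l. k < n \<Longrightarrow> i < n \<Longrightarrow> j < n \<Longrightarrow> l < n \<Longrightarrow> e k i * y * e j l = d i j *s e k l"
    and dy: "y = (\<Sum>i<n. \<Sum>j<n. d i j *s e i j)"
    by (rule matrix_units_corner[OF e y(1)]) blast
  obtain k l where kl: "k < n" "l < n" "c k l \<noteq> 0"
  proof (rule ccontr)
    assume "\<not> thesis"
    then have "\<And>k l. k < n \<Longrightarrow> l < n \<Longrightarrow> c k l = 0" using that by blast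
    then have "x = 0" by (subst cx) simp
    with x show False by simp
  qed
  obtain p q where pq: "p < n" "q < n" "d p q \<noteq> 0"
  proof (rule ccontr)
    assume "\<not> thesis"
    then have "\<And>k l. k < n \<Longrightarrow> l < n \<Longrightarrow> d k l = 0" using that by blast
    then have "y = 0" by (subst dy) simp
    with y show False by simp
  qed
  let ?z = "x * e l p * y"
  let ?t = "inverse (c k l * d p q) *s e q k"
  have absorb: "e i j * (e j l' * w) = e i l' * w" if "i < n" "j < n" "l' < n" for i j l' w
    using that by (simp add: matrix_unitsD(2)[OF e] flip: mult.assoc)
  have sandwich: "e k k * ?z * e q q = (c k l * d p q) *s e k q"
  proof -
    have "e k k * ?z * e q q = (e k k * x * e l l) * (e l p * y * e q q)"
      using kl pq by (simp add: mult.assoc absorb)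
    then show ?thesis
      using kl pq by (simp add: c d scale_mult_left scale_mult_right matrix_unitsD(2)[OF e] mult.commute)
  qed
  have nz: "?z \<noteq> 0"
  proof
    assume "?z = 0"
    then have "(c k l * d p q) *s e k q = 0" using sandwich by simp
    then show False
      using kl pq matrix_unit_nonzero[OF e kl(1) pq(2)] by simp
  qed
  have mid: "e l p * y * e q k * x * e l p = (c k l * d p q) *s e l p"
  proof -
    have "e l p * y * e q k * x * e l p = (e l p * y * e q k) * (e k k * x * e l p)"
      using kl pq by (simp add: mult.assoc absorb)
    then show ?thesis
      using kl pq by (simp add: c d scale_mult_left scale_mult_right matrix_unitsD(2)[OF e] mult.commute)
  qed
  have "?z * ?t * x * e l p * y = inverse (c k l * d p q) *s (x * (e l p * y * e q k * x * e l p) * y)"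
    by (simp add: scale_mult_left scale_mult_right mult.assoc)
  also have "\<dots> = (inverse (c k l * d p q) * (c k l * d p q)) *s ?z"
    unfolding mid by (simp only: scale_mult_left scale_mult_right scale_scale)
  also have "\<dots> = ?z"
    using kl pq by (subst left_inverse) simp_all
  finally have "?z * ?t * x * e l p * y = ?z" .
  then show thesis
    using that[of "e l p" ?t] nz kl pq matrix_unitsD(1)[OF e]
    by (simp add: subalgebra_closed(5)[OF sub])
qed

text \<open>
  Orthogonal nonzero idempotents are linearly independent, so their number is at most the dimension.
\<close>

lemma orthogonal_idempotents_bounded:
  assumes e: "matrix_units n e B"
    and r: "\<And>i. i < k \<Longrightarrow> r i \<in> B \<and> r i \<noteq> 0"
    and orth: "\<And>i j. i < k \<Longrightarrow> j < k \<Longrightarrow> r i * r j = (if i = j then r i else 0)"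
  shows "k \<le> n * n"
proof -
  have inj: "inj_on r {..<k}"
  proof (rule inj_onI)
    fix i j assume "i \<in> {..<k}" "j \<in> {..<k}" "r i = r j"
    then show "i = j" using orth[of i j] orth[of j j] r[of j] by (auto split: if_splits)
  qed
  have indep: "independent (r ` {..<k})"
  proof (rule independent_if_scalars_zero)
    fix f x assume 0: "(\<Sum>x\<in>r ` {..<k}. f x *s x) = 0" and "x \<in> r ` {..<k}"
    then obtain i where i: "i < k" "x = r i" by auto
    have "0 = (\<Sum>j<k. f (r j) *s r j) * r i"
      using 0 by (simp add: sum.reindex[OF inj])
    also have "\<dots> = (\<Sum>j<k. f (r j) *s (r j * r i))"
      by (simp add: sum_distrib_right scale_mult_left)
    also have "\<dots> = (\<Sum>j<k. if j = i then f (r i) *s r i else 0)"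
      using i by (intro sum.cong) (auto simp: orth)
    also have "\<dots> = f x *s r i" using i by simp
    finally show "f x = 0" using r[OF i(1)] by simp
  qed simp
  have spanned: "r ` {..<k} \<subseteq> span ((\<lambda>(i, j). e i j) ` ({..<n} \<times> {..<n}))" 
  proof
    fix x assume "x \<in> r ` {..<k}"
    then have "x \<in> B" using r by auto
    then obtain c where x: "x = (\<Sum>i<n. \<Sum>j<n. c i j *s e i j)"
      using matrix_unitsD(4)[OF e] by blast
    show "x \<in> span ((\<lambda>(i, j). e i j) ` ({..<n} \<times> {..<n}))"
      unfolding x by (intro span_sum span_scale span_base) auto
  qed
  have "card (r ` {..<k}) \<le> card ((\<lambda>(i, j). e i j) ` ({..<n} \<times> {..<n}))"
    by (rule conjunct2[OF independent_span_bound[OF _ indep spanned]]) simp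
  also have "\<dots> \<le> card ({..<n} \<times> {..<n})"
    by (rule card_image_le) simp
  finally show ?thesis
    by (simp add: card_image[OF inj])
qed

text \<open>
  Two idempotents of a matrix algebra are comparable up to equivalence: either \<open>e\<close> is equivalent to
  a part of \<open>f\<close> or \<open>f\<close> to a part of \<open>e\<close>. The pair \<open>(u, v)\<close> is built up greedily. While
  neither \<open>u v = e\<close> nor \<open>v u = f\<close>, the complements \<open>e - u v\<close> and \<open>f - v u\<close> are nonzero, and a
  link between them enlarges \<open>u\<close> and \<open>v\<close>. Each enlargement contributes a further idempotent to an
  orthogonal family below \<open>u v\<close>, and such families have bounded length.
\<close>

lemma idempotents_comparable:
  assumes E: "matrix_units n E B" and sub: "subalgebra B"
    and e: "e \<in> B" "e * e = e" and f: "f \<in> B" "f * f = f"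
  obtains u v where "u \<in> B" "v \<in> B" "e * u = u" "u * f = u" "f * v = v" "v * e = v"
    "u * v = e \<or> v * u = f"
proof -
  note closed = subalgebra_closed[OF sub]
  define partial where "partial u v \<longleftrightarrow> u \<in> B \<and> v \<in> B \<and> e * u = u \<and> u * f = u \<and> f * v = v \<and> v * e = v
    \<and> u * v * u = u \<and> v * u * v = v" for u v
  define chain where "chain k r u v \<longleftrightarrow> (\<forall>i<k. r i \<in> B \<and> r i \<noteq> 0) \<and>
    (\<forall>i<k. \<forall>j<k. r i * r j = (if i = j then r i else 0)) \<and>
    (\<forall>i<k. u * v * r i = r i \<and> r i * (u * v) = r i)" for k and r :: "nat \<Rightarrow> 'a" and u v
  have "(\<exists>u v. partial u v \<and> (u * v = e \<or> v * u = f)) \<or> (\<exists>r u v. partial u v \<and> chain k r u v)" for k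
  proof (induction k)
    case 0
    have "partial 0 0" by (simp add: partial_def closed)
    then show ?case unfolding chain_def by blast
  next
    case (Suc k)
    show ?case
    proof (cases "\<exists>u v. partial u v \<and> (u * v = e \<or> v * u = f)")
      case False
      then obtain r u v where p: "partial u v" and ch: "chain k r u v"
        using Suc.IH by blast
      have uv: "u \<in> B" "v \<in> B" "e * u = u" "u * f = u" "f * v = v" "v * e = v"
        "u * v * u = u" "v * u * v = v"
        using p by (auto simp: partial_def)
      have "u * v \<noteq> e" "v * u \<noteq> f" using False p by auto
      then have nz: "e - u * v \<noteq> 0" "f - v * u \<noteq> 0" by auto
      have inB: "e - u * v \<in> B" "f - v * u \<in> B"
        by (intro closed uv e f)+
      obtain w t where wt: "w \<in> B" "t \<in> B" "(e - u * v) * w * (f - v * u) \<noteq> 0"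
        "(e - u * v) * w * (f - v * u) * t * (e - u * v) * w * (f - v * u)
           = (e - u * v) * w * (f - v * u)"
        by (rule matrix_units_link[OF E sub inB(1) nz(1) inB(2) nz(2)])
      define e' where "e' = e - u * v"
      define f' where "f' = f - v * u"
      have e'B: "e' \<in> B" "f' \<in> B" using uv e f by (auto simp: e'_def f'_def intro: closed)
      have a: "e * e' = e'" "e' * e = e'" "f * f' = f'" "f' * f = f'" "v * e' = 0" "e' * u = 0"
        "u * f' = 0" "f' * v = 0"
        using uv e f
        by (simp_all add: e'_def f'_def left_diff_distrib mult.assoc)
          (simp_all add: right_diff_distrib flip: mult.assoc)
      \<comment> \<open>The outer factors put \<open>y\<close> into the corner between \<open>f'\<close> and \<open>e'\<close>, and repeating \<open>t z t\<close>
        makes \<open>y\<close> a reflexive inverse of \<open>z\<close>.\<close>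
      define z where "z = e' * w * f'"
      define y where "y = f' * t * z * t * e'"
      have zt: "z * t * z = z" "z \<noteq> 0"
        using wt(3,4) by (simp_all add: z_def e'_def f'_def mult.assoc)
      have zB: "z \<in> B" "y \<in> B"
        unfolding z_def y_def by (intro closed e'B wt)+
      have e'e': "e' * e' = e'" "f' * f' = f'"
        using a by (simp_all add: e'_def f'_def right_diff_distrib flip: mult.assoc)
      have z': "e' * z = z" "z * f' = z" "e * z = z" "z * f = z"
        using a e'e' by (simp_all add: z_def mult.assoc) (simp_all flip: mult.assoc)
      have y': "f' * y = y" "y * e' = y" "f * y = y" "y * e = y"
        using a e'e' by (simp_all add: y_def mult.assoc) (simp_all flip: mult.assoc)
      have zyz: "z * y * z = z"
      proof -
        have "z * y * z = (z * f') * t * z * t * (e' * z)" by (simp add: y_def mult.assoc)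
        also have "\<dots> = (z * t * z) * t * z" by (simp add: z' mult.assoc)
        also have "\<dots> = z" by (simp add: zt)
        finally show ?thesis .
      qed
      have yzy: "y * z * y = y"
      proof -
        have "y * z * y = f' * t * z * t * (e' * z) * f' * t * z * t * e'" 
          by (simp add: y_def mult.assoc)
        also have "\<dots> = f' * t * ((z * t * (z * f')) * t * z) * t * e'" by (simp add: z' mult.assoc)
        also have "\<dots> = f' * t * z * t * e'" by (simp add: z' zt)
        finally show ?thesis by (simp add: y_def)
      qed
      have vz: "v * z = 0"
      proof -
        have "v * z = (v * e') * z" by (simp add: z' mult.assoc)
        then show ?thesis by (simp add: a)
      qed
      have zv: "z * v = 0"
      proof -
        have "z * v = z * (f' * v)" by (simp add: z' flip: mult.assoc)
        then show ?thesis by (simp add: a)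
      qed
      have uy: "u * y = 0"
      proof -
        have "u * y = (u * f') * y" by (simp add: y' mult.assoc)
        then show ?thesis by (simp add: a)
      qed
      have yu: "y * u = 0"
      proof -
        have "y * u = y * (e' * u)" by (simp add: y' flip: mult.assoc)
        then show ?thesis by (simp add: a)
      qed
      have prod: "(u + z) * (v + y) = u * v + z * y" "(v + y) * (u + z) = v * u + y * z"
        by (simp_all add: distrib_left distrib_right uy zv vz yu)
      have zu: "z * y * u = 0" "u * v * z = 0" "y * z * v = 0" "v * u * y = 0" "z * y * (u * v) = 0"
        by (simp_all add: mult.assoc yu vz zv uy) (simp_all add: yu flip: mult.assoc)
      have p': "partial (u + z) (v + y)"
        unfolding partial_def prod
        by (simp add: distrib_left distrib_right uv z' y' closed zB zu zyz yzy)
      let ?r = "r(k := z * y)"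
      have r: "\<And>i. i < k \<Longrightarrow> r i \<in> B" "\<And>i. i < k \<Longrightarrow> r i \<noteq> 0"
        "\<And>i j. i < k \<Longrightarrow> j < k \<Longrightarrow> r i * r j = (if i = j then r i else 0)"
        "\<And>i. i < k \<Longrightarrow> u * v * r i = r i" "\<And>i. i < k \<Longrightarrow> r i * (u * v) = r i"
        using ch by (auto simp: chain_def)
      have rz: "r i * (z * y) = 0" if "i < k" for i
      proof -
        have "r i * (z * y) = r i * (u * v * z) * y" 
          using r(5)[OF that] by (simp flip: mult.assoc)
        then show ?thesis by (simp add: zu)
      qed
      have zr: "z * y * r i = 0" if "i < k" for i
      proof -
        have "z * y * r i = z * y * (u * v) * r i" 
          using r(4)[OF that] by (simp add: mult.assoc)
        then show ?thesis by (simp add: zu)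
      qed
      have zy: "z * y \<in> B" "z * y \<noteq> 0" "z * y * (z * y) = z * y"
        using zB zyz zt by (auto intro: closed simp flip: mult.assoc)
      have zyuv: "u * v * (z * y) = 0" "z * y * (u * v) = 0"
        using zu by (simp_all flip: mult.assoc)
      have "chain (Suc k) ?r (u + z) (v + y)"
        unfolding chain_def prod
      proof (intro conjI allI impI)
        fix i assume i: "i < Suc k"
        show "?r i \<in> B" "?r i \<noteq> 0"
          using i r(1,2)[of i] zy by (auto simp: less_Suc_eq)
        show "(u * v + z * y) * ?r i = ?r i" "?r i * (u * v + z * y) = ?r i"
          using i r(4,5)[of i] zy zyuv rz[of i] zr[of i]
          by (auto simp: less_Suc_eq distrib_left distrib_right)
      next
        fix i j assume "i < Suc k" "j < Suc k"
        then show "?r i * ?r j = (if i = j then ?r i else 0)"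
          using r(3)[of i j] zy rz[of i] zr[of j] by (auto simp: less_Suc_eq)
      qed
      with p' show ?thesis by blast
    qed simp
  qed
  from this[of "Suc (n * n)"]
  show thesis
  proof
    assume "\<exists>r u v. partial u v \<and> chain (Suc (n * n)) r u v"
    then obtain r u v where "chain (Suc (n * n)) r u v" by blast
    then have "Suc (n * n) \<le> n * n"
      using orthogonal_idempotents_bounded[OF E, of "Suc (n * n)" r] unfolding chain_def by blast
    then show thesis by simp
  next
    assume "\<exists>u v. partial u v \<and> (u * v = e \<or> v * u = f)"
    then obtain u v where uv: "partial u v" "u * v = e \<or> v * u = f" by blast
    show thesis
      by (rule that[of u v]) (use uv in \<open>simp_all add: partial_def\<close>)
  qed
qed

text \<open>
  If \<open>u\<close> and \<open>v\<close> compare the corners \<open>e 0 0\<close> and \<open>f 0 0\<close>, the sum of the shifted copies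
  \<open>e i 0 * u * f 0 i\<close> intertwines the two systems whatever \<open>u\<close> is; comparability makes it
  invertible on one side, and hence on both.
\<close>

lemma matrix_units_conjugate:
  fixes e f :: "nat \<Rightarrow> nat \<Rightarrow> 'a"
  assumes M: "matrix_subalgebra N M" and one: "1 \<in> M"
    and n: "0 < n"
    and eM: "\<And>i j. i < n \<Longrightarrow> j < n \<Longrightarrow> e i j \<in> M"
    and fM: "\<And>i j. i < n \<Longrightarrow> j < n \<Longrightarrow> f i j \<in> M"
    and e: "\<And>i j k l. i < n \<Longrightarrow> j < n \<Longrightarrow> k < n \<Longrightarrow> l < n \<Longrightarrow> e i j * e k l = (if j = k then e i l else 0)"
    and f: "\<And>i j k l. i < n \<Longrightarrow> j < n \<Longrightarrow> k < n \<Longrightarrow> l < n \<Longrightarrow> f i j * f k l = (if j = k then f i l else 0)"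
    and e1: "(\<Sum>i<n. e i i) = 1" and f1: "(\<Sum>i<n. f i i) = 1"
  obtains a b where "a * b = 1" "b * a = 1" "\<And>i j. i < n \<Longrightarrow> j < n \<Longrightarrow> b * e i j * a = f i j"
proof -
  have sub: "subalgebra M" using M by (simp add: matrix_subalgebra_def)
  note closed = subalgebra_closed[OF sub]
  obtain E where E: "matrix_units N E M"
    using matrix_subalgebra_has_units[OF M one] .
  obtain u v where uv: "u \<in> M" "v \<in> M" "e 0 0 * u = u" "u * f 0 0 = u" "f 0 0 * v = v" "v * e 0 0 = v"
    and disj: "u * v = e 0 0 \<or> v * u = f 0 0"
    by (rule idempotents_comparable[OF E sub eM[OF n n] _ fM[OF n n]]) (simp_all add: e f n)
  define a where "a = (\<Sum>i<n. e i 0 * u * f 0 i)"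
  define b where "b = (\<Sum>i<n. f i 0 * v * e 0 i)"
  have uf: "u * (f 0 0 * x) = u * x" and ve: "v * (e 0 0 * x) = v * x" for x
    using uv by (simp_all flip: mult.assoc)
  have aM: "a \<in> M" "b \<in> M"
    using n by (auto simp: a_def b_def intro!: closed eM fM uv)
  have ab: "a * b = 1" if "u * v = e 0 0"
  proof -
    have "a * b = (\<Sum>i<n. \<Sum>j<n. e i 0 * u * (f 0 i * f j 0) * v * e 0 j)"
      by (simp add: a_def b_def sum_product mult.assoc)
    also have "\<dots> = (\<Sum>i<n. \<Sum>j<n. if j = i then e i 0 * (u * v) * e 0 j else 0)"
      using n uf by (intro sum.cong) (auto simp: f mult.assoc)
    also have "\<dots> = (\<Sum>i<n. e i 0 * (u * v) * e 0 i)"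
      by (intro sum.cong refl) simp
    also have "\<dots> = (\<Sum>i<n. e i i)"
      using n by (intro sum.cong) (auto simp: that e)
    finally show ?thesis by (simp add: e1)
  qed
  have ba: "b * a = 1" if "v * u = f 0 0"
  proof -
    have "b * a = (\<Sum>i<n. \<Sum>j<n. f i 0 * v * (e 0 i * e j 0) * u * f 0 j)"
      by (simp add: a_def b_def sum_product mult.assoc)
    also have "\<dots> = (\<Sum>i<n. \<Sum>j<n. if j = i then f i 0 * (v * u) * f 0 j else 0)"
      using n ve by (intro sum.cong) (auto simp: e mult.assoc)
    also have "\<dots> = (\<Sum>i<n. f i 0 * (v * u) * f 0 i)"
      by (intro sum.cong refl) simp
    also have "\<dots> = (\<Sum>i<n. f i i)"
      using n by (intro sum.cong) (auto simp: that f)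
    finally show ?thesis by (simp add: f1)
  qed
  have inv: "a * b = 1" "b * a = 1"
    using disj ab ba matrix_subalgebra_left_right_inverse[OF M one] aM by blast+
  have intertwine: "e i j * a = a * f i j" if "i < n" "j < n" for i j
  proof -
    have "e i j * a = (\<Sum>k<n. (e i j * e k 0) * u * f 0 k)"
      by (simp add: a_def sum_distrib_left mult.assoc)
    also have "\<dots> = (\<Sum>k<n. if k = j then e i 0 * u * f 0 j else 0)"
      using that n by (intro sum.cong) (auto simp: e)
    also have "\<dots> = (\<Sum>k<n. if k = i then e i 0 * u * f 0 j else 0)"
      using that by simp
    also have "\<dots> = (\<Sum>k<n. e k 0 * u * (f 0 k * f i j))"
      using that n by (intro sum.cong) (auto simp: f)
    also have "\<dots> = a * f i j"
      by (simp add: a_def sum_distrib_right mult.assoc)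
    finally show ?thesis .
  qed
  have "b * e i j * a = f i j" if "i < n" "j < n" for i j
  proof -
    have "b * e i j * a = (b * a) * f i j" by (simp add: mult.assoc intertwine that)
    then show ?thesis by (simp add: inv)
  qed
  with inv that show thesis by blast
qed

end

section \<open>Inner automorphisms\<close>

lemma conjugations_comp:
  assumes "g \<in> conjugations UNIV" "h \<in> conjugations UNIV"
  shows "g \<circ> h \<in> conjugations UNIV"
proof -
  obtain a b where g: "g = (\<lambda>x. b * x * a)" "a * b = 1" "b * a = 1"
    using assms(1) by (auto simp: conjugations_def)
  obtain a' b' where h: "h = (\<lambda>x. b' * x * a')" "a' * b' = 1" "b' * a' = 1"
    using assms(2) by (auto simp: conjugations_def)
  have "(a' * a) * (b * b') = a' * (a * b) * b'" "(b * b') * (a' * a) = b * (b' * a') * a"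
    by (simp_all only: mult.assoc)
  then have "(a' * a) * (b * b') = 1" "(b * b') * (a' * a) = 1"
    using g h by simp_all
  moreover have "g \<circ> h = (\<lambda>x. (b * b') * x * (a' * a))"
    by (simp add: g h fun_eq_iff mult.assoc)
  ultimately show ?thesis
    unfolding conjugations_def by blast
qed

lemma conjugations_inverse:
  assumes "g \<in> conjugations UNIV"
  obtains h where "h \<in> conjugations UNIV" "h \<circ> g = id" "g \<circ> h = id"
proof -
  obtain a b where g: "g = (\<lambda>x. b * x * a)" "a * b = 1" "b * a = 1"
    using assms by (auto simp: conjugations_def)
  have "b * (a * x) = x" "a * (b * x) = x" for x
    using g by (simp_all flip: mult.assoc)
  then have "(\<lambda>x. a * x * b) \<circ> g = id" "g \<circ> (\<lambda>x. a * x * b) = id"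
    using g by (simp_all add: fun_eq_iff mult.assoc)
  moreover have "(\<lambda>x. a * x * b) \<in> conjugations UNIV"
    using g unfolding conjugations_def by blast
  ultimately show thesis by (intro that)
qed

lemma id_in_conjugations: "id \<in> conjugations UNIV"
proof -
  have "id = (\<lambda>x::'a::ring_1. 1 * x * 1)" by (simp add: fun_eq_iff)
  moreover have "(1::'a) * 1 = 1" by simp
  ultimately show ?thesis unfolding conjugations_def by blast
qed

lemma Inn_group: "group Inn"
proof (rule groupI)
  fix g :: "'a \<Rightarrow> 'a" assume "g \<in> carrier Inn"
  then show "\<exists>h\<in>carrier Inn. h \<otimes>\<^bsub>Inn\<^esub> g = \<one>\<^bsub>Inn\<^esub>"
    unfolding Inn_def by simp (metis conjugations_inverse)
qed (simp_all add: Inn_def conjugations_comp id_in_conjugations comp_assoc)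

section \<open>Infinite products\<close>

lemma partial_composition_Suc:
  "partial_composition f (Suc m) = partial_composition f m \<circ> f m"
proof -
  have "foldr (\<circ>) hs g = foldr (\<circ>) hs id \<circ> g" for hs and g :: "'a \<Rightarrow> 'a"
    by (induction hs) (auto simp: comp_assoc)
  from this[of "map f [0..<m]" "f m"] show ?thesis
    by (simp add: partial_composition_def)
qed

lemma partial_composition_0: "partial_composition f 0 = id"
  by (simp add: partial_composition_def)

lemma partial_composition_cong:
  assumes "\<And>i. i < m \<Longrightarrow> f i = g i"
  shows "partial_composition f m = partial_composition g m"
  using assms by (induction m) (simp_all add: partial_composition_0 partial_composition_Suc)

lemma partial_composition_inner:
  assumes "\<And>i. i < m \<Longrightarrow> f i \<in> conjugations UNIV"
  shows "partial_composition f m \<in> conjugations UNIV"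
  using assms
  by (induction m)
    (simp_all add: partial_composition_0 partial_composition_Suc id_in_conjugations conjugations_comp)

text \<open>
  In a product of discrete spaces, convergence means that each value is eventually constant.
\<close>

lemma has_infinite_product_iff:
  "has_infinite_product f g \<longleftrightarrow> (\<forall>x. \<forall>\<^sub>F m in sequentially. partial_composition f m x = g x)"
proof -
  have "limitin (discrete_topology UNIV) u l sequentially \<longleftrightarrow> (\<forall>\<^sub>F m in sequentially. u m = l)"
    for u :: "nat \<Rightarrow> 'a" and l
  proof
    assume "limitin (discrete_topology UNIV) u l sequentially"
    then have "\<forall>\<^sub>F m in sequentially. u m \<in> {l}"
      unfolding limitin_def by (metis openin_discrete_topology singletonI subset_UNIV)
    then show "\<forall>\<^sub>F m in sequentially. u m = l" by simp
  next
    assume "\<forall>\<^sub>F m in sequentially. u m = l"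
    then show "limitin (discrete_topology UNIV) u l sequentially"
      unfolding limitin_def by (auto elim: eventually_mono)
  qed
  then show ?thesis
    by (simp add: has_infinite_product_def limitin_componentwise)
qed

context unital_algebra
begin

section \<open>Injective endomorphisms\<close>

lemma endoD:
  assumes "\<phi> \<in> unital_injective_endos"
  shows "\<phi> (x + y) = \<phi> x + \<phi> y" "\<phi> (c *s x) = c *s \<phi> x" "\<phi> (x * y) = \<phi> x * \<phi> y" "\<phi> 1 = 1" "inj \<phi>"
  using assms by (auto simp: unital_injective_endos_def Vector_Spaces.linear_iff)

lemma endo_zero: "\<phi> \<in> unital_injective_endos \<Longrightarrow> \<phi> 0 = 0"
  using endoD(2)[of \<phi> 0 0] by simp

lemma endo_sum:
  assumes "\<phi> \<in> unital_injective_endos"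
  shows "\<phi> (sum f S) = (\<Sum>i\<in>S. \<phi> (f i))"
  by (induction S rule: infinite_finite_induct) (simp_all add: endo_zero endoD(1) assms)

lemma endo_comp:
  assumes "\<phi> \<in> unital_injective_endos" "\<psi> \<in> unital_injective_endos"
  shows "\<phi> \<circ> \<psi> \<in> unital_injective_endos"
  using endoD[OF assms(1)] endoD[OF assms(2)]
  unfolding unital_injective_endos_def
  by (simp add: Vector_Spaces.linear_iff vector_space_axioms inj_compose del: o_apply)
    (simp add: o_apply)

lemma inner_endo:
  assumes "h \<in> conjugations UNIV"
  shows "h \<in> unital_injective_endos"
proof -
  obtain a b where h: "h = (\<lambda>x. b * x * a)" "a * b = 1" "b * a = 1"
    using assms by (auto simp: conjugations_def)
  have "b * (x * y) * a = b * x * a * (b * y * a)" for x y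
  proof -
    have "b * x * a * (b * y * a) = b * x * (a * b) * y * a" by (simp add: mult.assoc)
    then show ?thesis by (simp add: h mult.assoc)
  qed
  moreover have "inj h"
    using conjugations_inverse[OF assms] by (metis inj_on_id inj_on_imageI2)
  ultimately show ?thesis
    unfolding unital_injective_endos_def
    by (simp add: Vector_Spaces.linear_iff vector_space_axioms h distrib_left distrib_right
      scale_mult_left scale_mult_right)
qed

text \<open>
  The endomorphism need not map \<open>M\<close> into itself, so the matrix units of \<open>M\<close> are compared with their
  images inside a larger matrix subalgebra that contains both systems.
\<close>

lemma endo_agrees_with_inner:
  assumes loc: "locally_matrix" and \<phi>: "\<phi> \<in> unital_injective_endos"
    and M: "matrix_subalgebra n M" and one: "1 \<in> M"
  obtains h where "h \<in> conjugations UNIV" "\<And>x. x \<in> M \<Longrightarrow> h x = \<phi> x"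
proof -
  obtain e where e: "matrix_units n e M"
    using matrix_subalgebra_has_units[OF M one] .
  define S where "S = (\<lambda>(i, j). e i j) ` ({..<n} \<times> {..<n})"
  have "finite (insert 1 (S \<union> \<phi> ` S))" by (simp add: S_def)
  then obtain N M' where M': "insert 1 (S \<union> \<phi> ` S) \<subseteq> M'" "matrix_subalgebra N M'"
    using loc unfolding locally_matrix_def by blast
  have eS: "e i j \<in> S" if "i < n" "j < n" for i j
    using that unfolding S_def by force
  have f_mult: "\<phi> (e i j) * \<phi> (e k l) = (if j = k then \<phi> (e i l) else 0)"
    if "i < n" "j < n" "k < n" "l < n" for i j k l
  proof -
    have "\<phi> (e i j) * \<phi> (e k l) = \<phi> (e i j * e k l)" by (simp add: endoD(3)[OF \<phi>])
    then show ?thesis using that by (simp add: matrix_unitsD(2)[OF e] endo_zero[OF \<phi>])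
  qed
  have f_one: "(\<Sum>i<n. \<phi> (e i i)) = 1"
    using matrix_unitsD(3)[OF e] by (simp flip: endo_sum[OF \<phi>] add: endoD(4)[OF \<phi>])
  obtain a b where ab: "a * b = 1" "b * a = 1"
    and conj: "\<And>i j. i < n \<Longrightarrow> j < n \<Longrightarrow> b * e i j * a = \<phi> (e i j)"
  proof (rule matrix_units_conjugate[OF M'(2) _ matrix_unitsD(5)[OF e], of e "\<lambda>i j. \<phi> (e i j)"])
    show "1 \<in> M'" using M' by simp
    show "\<And>i j. i < n \<Longrightarrow> j < n \<Longrightarrow> e i j \<in> M'" "\<And>i j. i < n \<Longrightarrow> j < n \<Longrightarrow> \<phi> (e i j) \<in> M'"
      using M' eS by blast+
  qed (use f_mult f_one matrix_unitsD(2,3)[OF e] in simp_all)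
  let ?h = "\<lambda>x. b * x * a"
  have inner: "?h \<in> conjugations UNIV"
    unfolding conjugations_def using ab by blast
  have "?h x = \<phi> x" if xM: "x \<in> M" for x
  proof -
    obtain c where x: "x = (\<Sum>i<n. \<Sum>j<n. c i j *s e i j)"
      using matrix_unitsD(4)[OF e xM] by blast
    have "?h x = (\<Sum>i<n. \<Sum>j<n. c i j *s (b * e i j * a))"
      by (simp add: x sum_distrib_left sum_distrib_right scale_mult_left scale_mult_right)
    also have "\<dots> = \<phi> x"
      by (simp add: x endo_sum[OF \<phi>] endoD(2)[OF \<phi>] conj)
    finally show ?thesis .
  qed
  with inner that show thesis by blast
qed

end

section \<open>Tails of the tensor product\<close>

locale matrix_tensor_product = unital_algebra scale
  for scale :: "'f::field \<Rightarrow> 'a::ring_1 \<Rightarrow> 'a" (infixr \<open>*s\<close> 75) +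
  fixes A :: "nat \<Rightarrow> 'a set" and d :: "nat \<Rightarrow> nat"
  assumes locally_matrix: "locally_matrix"
    and tensor: "infinite_tensor_product A"
    and factors: "matrix_subalgebra (d i) (A i)"
begin

lemma one_in_factor: "1 \<in> A i"
  and factors_commute: "i \<noteq> j \<Longrightarrow> x \<in> A i \<Longrightarrow> y \<in> A j \<Longrightarrow> x * y = y * x"
  using tensor unfolding infinite_tensor_product_def by blast+

lemma tuples_exhaust:
  obtains m where "x \<in> span (prod_list ` tuples A m)"
proof -
  obtain m p where p: "p \<in> free_tuples A m" "x = tensor_eval p"
    using tensor unfolding infinite_tensor_product_def by blast
  have "x \<in> span (prod_list ` tuples A m)"
    unfolding p(2) tensor_eval_def
    by (intro span_sum span_scale span_base) (use p(1) in \<open>auto simp: free_tuples_def\<close>)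
  then show thesis by (rule that)
qed

lemma subspace_centralizer: "subspace {x. x * a = a * x}"
  by (rule subspaceI) (simp_all add: distrib_left distrib_right scale_mult_left scale_mult_right)

lemma prod_list_commute:
  fixes a :: 'a
  assumes "\<And>y. y \<in> set ys \<Longrightarrow> y * a = a * y"
  shows "prod_list ys * a = a * prod_list ys"
  using assms
proof (induction ys)
  case (Cons y ys)
  then have "y * (prod_list ys * a) = y * (a * prod_list ys)" by simp
  also have "\<dots> = (y * a) * prod_list ys" by (simp only: mult.assoc)
  also have "y * a = a * y" using Cons.prems by simp
  finally show ?case by (simp add: mult.assoc)
qed simp

lemma tensor_tail_commute:
  assumes "x \<in> tensor_tail A n" "i < n" "a \<in> A i"
  shows "x * a = a * x"
proof -
  have "tensor_tail A n \<subseteq> {x. x * a = a * x}"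
    unfolding tensor_tail_def
  proof (rule span_minimal[OF _ subspace_centralizer], safe)
    fix xs m assume xs: "xs \<in> tuples A m" "\<forall>i<m. i < n \<longrightarrow> xs ! i = 1"
    show "prod_list xs * a = a * prod_list xs"
    proof (rule prod_list_commute)
      fix y assume "y \<in> set xs"
      then obtain j where j: "j < m" "y = xs ! j"
        using xs(1) by (auto simp: tuples_def in_set_conv_nth)
      then have y: "y \<in> A j" using xs(1) by (auto simp: tuples_def)
      show "y * a = a * y"
      proof (cases "j = i")
        case True
        then show ?thesis using xs(2) j assms(2) by simp
      next
        case False
        then show ?thesis using factors_commute y assms(3) by blast
      qed
    qed
  qed
  with assms(1) show ?thesis by blast
qed

text \<open>
  The map \<open>E y = (\<Sum>k<d n. e k 0 * y * e 0 k)\<close>, with matrix units \<open>e\<close> of \<open>A n\<close>, replaces the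
  component in \<open>A n\<close> of a pure tensor by the scalar that is its top left coordinate. It thus maps
  the tail from position \<open>n\<close> into the next one, while it fixes every element that commutes with \<open>A n\<close>.
\<close>

lemma tensor_tail_Suc:
  assumes x: "x \<in> tensor_tail A n" and comm: "\<And>a. a \<in> A n \<Longrightarrow> x * a = a * x"
  shows "x \<in> tensor_tail A (Suc n)"
proof -
  obtain e where e: "matrix_units (d n) e (A n)"
    using matrix_subalgebra_has_units[OF factors one_in_factor] .
  note eA = matrix_unitsD(1)[OF e] and d = matrix_unitsD(5)[OF e]
  define E where "E y = (\<Sum>k<d n. e k 0 * y * e 0 k)" for y
  have E_central: "E y = y" if "\<And>a. a \<in> A n \<Longrightarrow> y * a = a * y" for y
  proof -
    have "E y = (\<Sum>k<d n. y * e k k)"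
      unfolding E_def
    proof (rule sum.cong)
      fix k assume "k \<in> {..<d n}"
      then have k: "k < d n" by simp
      have "e k 0 * y * e 0 k = y * (e k 0 * e 0 k)"
        using that[OF eA[OF k d]] by (simp flip: mult.assoc)
      then show "e k 0 * y * e 0 k = y * e k k"
        using k d by (simp add: matrix_unitsD(2)[OF e])
    qed simp
    also have "\<dots> = y"
      by (simp add: matrix_unitsD(3)[OF e] flip: sum_distrib_left)
    finally show ?thesis .
  qed
  have "subspace {y. E y \<in> tensor_tail A (Suc n)}"
  proof (rule subspaceI; clarify)
    show "E 0 \<in> tensor_tail A (Suc n)"
      by (simp add: E_def tensor_tail_def span_zero)
    fix y assume y: "E y \<in> tensor_tail A (Suc n)"
    have "E (c *s y) = c *s E y" for c
      by (simp add: E_def scale_sum_right scale_mult_left scale_mult_right)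
    with y show "E (c *s y) \<in> tensor_tail A (Suc n)" for c
      by (simp add: tensor_tail_def span_scale)
    fix z assume z: "E z \<in> tensor_tail A (Suc n)"
    have "E (y + z) = E y + E z"
      by (simp add: E_def distrib_left distrib_right sum.distrib)
    with y z show "E (y + z) \<in> tensor_tail A (Suc n)"
      by (simp add: tensor_tail_def span_add)
  qed
  then have "tensor_tail A n \<subseteq> {y. E y \<in> tensor_tail A (Suc n)}"
    unfolding tensor_tail_def[of A n]
  proof (rule span_minimal[rotated], safe)
    fix xs m assume xs: "xs \<in> tuples A m" "\<forall>i<m. i < n \<longrightarrow> xs ! i = 1"
    have nth: "xs ! j \<in> A j" if "j < m" for j
      using xs(1) that by (simp add: tuples_def)
    have len: "length xs = m" using xs(1) by (simp add: tuples_def)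
    have others: "prod_list ys * a = a * prod_list ys"
      if a: "a \<in> A n" and ys: "\<And>y. y \<in> set ys \<Longrightarrow> \<exists>j<m. j \<noteq> n \<and> y = xs ! j" for ys a
      by (rule prod_list_commute) (metis a ys nth factors_commute)
    show "E (prod_list xs) \<in> tensor_tail A (Suc n)"
    proof (cases "n < m")
      case False
      \<comment> \<open>A tuple too short to reach position \<open>n\<close> consists of units.\<close>
      have "E (prod_list xs) = prod_list xs"
        by (rule E_central, rule others) (use False len in \<open>auto simp: in_set_conv_nth\<close>)
      moreover have "prod_list xs \<in> tensor_tail A (Suc n)"
        unfolding tensor_tail_def using False xs by (intro span_base imageI) auto
      ultimately show ?thesis by simp
    next
      case True
      define L where "L = prod_list (take n xs)"
      define R where "R = prod_list (drop (Suc n) xs)"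
      have L: "L * a = a * L" if "a \<in> A n" for a
        unfolding L_def
      proof (rule others[OF that])
        fix y assume "y \<in> set (take n xs)"
        then obtain j where "j < n" "y = xs ! j"
          by (auto simp: in_set_conv_nth)
        with True show "\<exists>j<m. j \<noteq> n \<and> y = xs ! j"
          by (intro exI[of _ j]) auto
      qed
      have R: "R * a = a * R" if "a \<in> A n" for a
        unfolding R_def
      proof (rule others[OF that])
        fix y assume "y \<in> set (drop (Suc n) xs)"
        then obtain j where "j < m - Suc n" "y = xs ! (Suc n + j)"
          using len by (auto simp: in_set_conv_nth)
        then show "\<exists>j<m. j \<noteq> n \<and> y = xs ! j"
          by (intro exI[of _ "Suc n + j"]) auto
      qed
      have split: "prod_list xs = L * (xs ! n) * R"
        using True len by (subst id_take_nth_drop[of n xs]) (simp_all add: L_def R_def mult.assoc)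
      obtain c where c: "\<And>k i j l. k < d n \<Longrightarrow> i < d n \<Longrightarrow> j < d n \<Longrightarrow> l < d n
          \<Longrightarrow> e k i * (xs ! n) * e j l = c i j *s e k l"
        by (rule matrix_units_corner[OF e nth[OF True]]) blast
      have "E (prod_list xs) = (\<Sum>k<d n. c 0 0 *s (L * e k k * R))"
        unfolding E_def
      proof (rule sum.cong)
        fix k assume "k \<in> {..<d n}"
        then have k: "k < d n" by simp
        have "e k 0 * prod_list xs * e 0 k = (e k 0 * L) * (xs ! n) * (R * e 0 k)"
          by (simp add: split mult.assoc)
        also have "\<dots> = L * (e k 0 * (xs ! n) * e 0 k) * R"
          by (simp add: mult.assoc R[OF eA[OF d k]] flip: L[OF eA[OF k d]])
        also have "\<dots> = c 0 0 *s (L * e k k * R)"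
          by (simp add: c k d scale_mult_left scale_mult_right)
        finally show "e k 0 * prod_list xs * e 0 k = c 0 0 *s (L * e k k * R)" .
      qed simp
      also have "\<dots> = c 0 0 *s (L * (\<Sum>k<d n. e k k) * R)"
        by (simp add: scale_sum_right sum_distrib_left sum_distrib_right)
      also have "\<dots> = c 0 0 *s (L * R)"
        by (simp add: matrix_unitsD(3)[OF e])
      also have "L * R = prod_list (xs[n := 1])"
        using True len by (simp add: upd_conv_take_nth_drop L_def R_def)
      finally have E: "E (prod_list xs) = c 0 0 *s prod_list (xs[n := 1])" .
      have "xs[n := 1] \<in> tuples A m"
        using True nth len one_in_factor[of n] by (auto simp: tuples_def nth_list_update)
      moreover have "\<forall>i<m. i < Suc n \<longrightarrow> xs[n := 1] ! i = 1"
        using xs(2) len by (auto simp: nth_list_update less_Suc_eq)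
      ultimately show ?thesis
        unfolding E tensor_tail_def by (intro span_scale span_base imageI) auto
    qed
  qed
  then show ?thesis
    using x E_central[OF comm] by auto
qed

text \<open>
  By induction on \<open>n\<close>, starting from the fact that the tail from position \<open>0\<close> is the whole algebra.
\<close>

lemma tensor_tail_iff_commute:
  "x \<in> tensor_tail A n \<longleftrightarrow> (\<forall>i<n. \<forall>a\<in>A i. x * a = a * x)"
proof
  assume "\<forall>i<n. \<forall>a\<in>A i. x * a = a * x"
  then show "x \<in> tensor_tail A n"
  proof (induction n)
    case 0
    obtain m where m: "x \<in> span (prod_list ` tuples A m)"
      using tuples_exhaust .
    have "span (prod_list ` tuples A m) \<subseteq> tensor_tail A 0"
      unfolding tensor_tail_def by (intro span_mono image_mono) auto
    with m show ?case by blast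
  next
    case (Suc n)
    then have "x \<in> tensor_tail A n" "\<forall>a\<in>A n. x * a = a * x"
      using less_Suc_eq by blast+
    then show ?case by (intro tensor_tail_Suc) auto
  qed
qed (use tensor_tail_commute in blast)

text \<open>
  Conjugation by \<open>a\<close> fixes an element exactly when \<open>a\<close> commutes with it, so the centralizer
  description of the tails turns into a description of \<open>H A n\<close>. In particular the conjugations by
  elements of a tail already form a group.
\<close>

lemma H_eq: "H A n = {h \<in> conjugations UNIV. \<forall>i<n. \<forall>x\<in>A i. h x = x}" (is "_ = ?F")
proof
  interpret Inn: group "Inn :: ('a \<Rightarrow> 'a) monoid" by (rule Inn_group)
  show "H A n \<subseteq> ?F"
    unfolding H_def
  proof (rule Inn.generate_subgroup_incl)
    show "conjugations (tensor_tail A n) \<subseteq> ?F"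
    proof
      fix h assume "h \<in> conjugations (tensor_tail A n)"
      then obtain a b where h: "h = (\<lambda>x. b * x * a)" "a \<in> tensor_tail A n" "a * b = 1" "b * a = 1"
        by (auto simp: conjugations_def)
      have "b * x * a = x" if "i < n" "x \<in> A i" for i x
      proof -
        have "b * x * a = b * a * x"
          using tensor_tail_commute[OF h(2) that] by (simp add: mult.assoc)
        then show ?thesis by (simp add: h)
      qed
      then show "h \<in> ?F"
        using h by (auto simp: conjugations_def)
    qed
    show "subgroup ?F Inn"
    proof (rule Inn.subgroupI)
      show "?F \<subseteq> carrier Inn" by (auto simp: Inn_def)
      have "id \<in> ?F" by (simp add: id_in_conjugations)
      then show "?F \<noteq> {}" by blast
    next
      fix g assume g: "g \<in> ?F"
      then have gI: "g \<in> carrier Inn" by (simp add: Inn_def)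
      have "inv\<^bsub>Inn\<^esub> g \<in> conjugations UNIV" "inv\<^bsub>Inn\<^esub> g \<circ> g = id"
        using Inn.inv_closed[OF gI] Inn.l_inv[OF gI] by (simp_all add: Inn_def)
      then show "inv\<^bsub>Inn\<^esub> g \<in> ?F"
        using g by (auto simp: fun_eq_iff) metis
    next
      fix g h assume "g \<in> ?F" "h \<in> ?F"
      then show "g \<otimes>\<^bsub>Inn\<^esub> h \<in> ?F"
        by (simp add: Inn_def conjugations_comp[unfolded comp_def] comp_def)
    qed
  qed
next
  show "?F \<subseteq> H A n"
  proof
    fix h assume F: "h \<in> ?F"
    then obtain a b where h: "h = (\<lambda>x. b * x * a)" "a * b = 1" "b * a = 1"
      by (auto simp: conjugations_def)
    have "a * x = x * a" if "i < n" "x \<in> A i" for i x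
    proof -
      have "a * (b * x * a) = a * x" using F h(1) that by auto
      moreover have "a * (b * x * a) = a * b * x * a" by (simp add: mult.assoc)
      ultimately show ?thesis by (simp add: h)
    qed
    then have "a \<in> tensor_tail A n"
      by (simp add: tensor_tail_iff_commute)
    then have "h \<in> conjugations (tensor_tail A n)"
      using h unfolding conjugations_def by blast
    then show "h \<in> H A n"
      unfolding H_def by (rule generate.incl)
  qed
qed

lemma in_left_coset_iff: "g \<in> h <#\<^bsub>Inn\<^esub> H A n \<longleftrightarrow> (\<exists>k\<in>H A n. g = h \<circ> k)"
  by (auto simp: l_coset_def Inn_def)

section \<open>Factorisation of endomorphisms\<close>

lemma factors_in_matrix_subalgebra:
  obtains N M where "matrix_subalgebra N M" "1 \<in> M" "\<And>i. i < m \<Longrightarrow> A i \<subseteq> M"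
proof -
  have "\<exists>e. matrix_units (d i) e (A i)" for i
    using matrix_subalgebra_has_units[OF factors one_in_factor] by blast
  then obtain e where e: "\<And>i. matrix_units (d i) (e i) (A i)"
    by metis
  define S where "S = insert 1 (\<Union>i<m. (\<lambda>(j, k). e i j k) ` ({..<d i} \<times> {..<d i}))"
  have "finite S" by (simp add: S_def)
  then obtain N M where M: "S \<subseteq> M" "matrix_subalgebra N M"
    using locally_matrix unfolding locally_matrix_def by blast
  then have sub: "subalgebra M" by (simp add: matrix_subalgebra_def)
  have "A i \<subseteq> M" if "i < m" for i
  proof
    fix x assume "x \<in> A i"
    then obtain c where x: "x = (\<Sum>j<d i. \<Sum>k<d i. c j k *s e i j k)"
      using matrix_unitsD(4)[OF e] by blast
    have "e i j k \<in> M" if "j < d i" "k < d i" for j k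
      using M(1) \<open>i < m\<close> that unfolding S_def by force
    then show "x \<in> M"
      unfolding x by (intro subalgebra_closed(5,6)[OF sub]) auto
  qed
  moreover have "1 \<in> M" using M(1) by (simp add: S_def)
  ultimately show thesis using M(2) that by blast
qed

text \<open>
  The factors below \<open>m\<close> generate the finite tensor product of these factors.
\<close>

lemma endos_agree_on_span:
  assumes \<phi>: "\<phi> \<in> unital_injective_endos" and \<psi>: "\<psi> \<in> unital_injective_endos"
    and agree: "\<And>i a. i < m \<Longrightarrow> a \<in> A i \<Longrightarrow> \<phi> a = \<psi> a"
    and x: "x \<in> span (prod_list ` tuples A m)"
  shows "\<phi> x = \<psi> x"
proof -
  have prod: "\<phi> (prod_list ys) = \<psi> (prod_list ys)" if "\<And>y. y \<in> set ys \<Longrightarrow> \<phi> y = \<psi> y" for ys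
    using that by (induction ys) (simp_all add: endoD[OF \<phi>] endoD[OF \<psi>])
  have "span (prod_list ` tuples A m) \<subseteq> {x. \<phi> x = \<psi> x}"
  proof (rule span_minimal)
    show "subspace {x. \<phi> x = \<psi> x}"
      by (rule subspaceI) (simp_all add: endoD[OF \<phi>] endoD[OF \<psi>] endo_zero \<phi> \<psi>)
    have "\<phi> y = \<psi> y" if "xs \<in> tuples A m" "y \<in> set xs" for xs y
      using that agree unfolding tuples_def in_set_conv_nth by blast
    then show "prod_list ` tuples A m \<subseteq> {x. \<phi> x = \<psi> x}"
      using prod by blast
  qed
  with x show ?thesis by blast
qed

text \<open>
  The inductive step of the existence proof. On the factors up to \<open>m\<close>, the endomorphism
  \<open>c\<inverse> \<circ> \<phi>\<close> agrees with an inner \<open>h\<close>, which lies in \<open>H A m\<close> because it fixes the factors below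
  \<open>m\<close>. Replacing \<open>h\<close> by the representative of its coset changes nothing on these factors.
\<close>

lemma extend_by_representative:
  assumes \<phi>: "\<phi> \<in> unital_injective_endos" and c: "c \<in> conjugations UNIV"
    and agree: "\<And>i a. i < m \<Longrightarrow> a \<in> A i \<Longrightarrow> c a = \<phi> a"
    and X: "left_coset_representatives Inn (H A m) (H A (Suc m)) X"
  shows "\<exists>g\<in>X. \<forall>i<Suc m. \<forall>a\<in>A i. c (g a) = \<phi> a"
proof -
  obtain c' where c': "c' \<in> conjugations UNIV" "c' \<circ> c = id" "c \<circ> c' = id"
    using conjugations_inverse[OF c] .
  obtain N M where M: "matrix_subalgebra N M" "1 \<in> M" "\<And>i. i < Suc m \<Longrightarrow> A i \<subseteq> M"
    using factors_in_matrix_subalgebra[of "Suc m"] by blast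
  have "c' \<circ> \<phi> \<in> unital_injective_endos"
    by (rule endo_comp[OF inner_endo[OF c'(1)] \<phi>])
  then obtain h where h: "h \<in> conjugations UNIV" "\<And>x. x \<in> M \<Longrightarrow> h x = (c' \<circ> \<phi>) x"
    using endo_agrees_with_inner[OF locally_matrix _ M(1,2)] by blast
  have hA: "h a = c' (\<phi> a)" if "i < Suc m" "a \<in> A i" for i a
    using h(2) M(3)[OF that(1)] that(2) by auto
  have "h a = a" if "i < m" "a \<in> A i" for i a
  proof -
    have "h a = c' (c a)" using hA[of i a] agree that by simp
    then show ?thesis using c'(2) by (simp add: fun_eq_iff)
  qed
  then have "h \<in> H A m" using h(1) by (simp add: H_eq)
  then obtain g where g: "g \<in> X" "g \<in> h <#\<^bsub>Inn\<^esub> H A (Suc m)"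
    using X unfolding left_coset_representatives_def by blast
  then obtain k where k: "k \<in> H A (Suc m)" "g = h \<circ> k"
    by (auto simp: in_left_coset_iff)
  have "c (g a) = \<phi> a" if "i < Suc m" "a \<in> A i" for i a
  proof -
    have "k a = a" using k(1) that by (simp add: H_eq)
    then have "c (g a) = c (c' (\<phi> a))" using k(2) hA[OF that] by simp
    then show ?thesis using c'(3) by (simp add: fun_eq_iff)
  qed
  with g(1) show ?thesis by blast
qed

lemma infinite_product_exists:
  assumes \<phi>: "\<phi> \<in> unital_injective_endos"
    and X: "\<And>k. left_coset_representatives Inn (H A k) (H A (Suc k)) (X k)"
  shows "\<exists>\<psi>. (\<forall>k. \<psi> k \<in> X k) \<and> has_infinite_product \<psi> \<phi>"
proof -
  define good where "good m c g \<longleftrightarrow> g \<in> X m \<and> (\<forall>i<Suc m. \<forall>a\<in>A i. c (g a) = \<phi> a)" for m c g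
  define C where "C = rec_nat id (\<lambda>m c. c \<circ> (SOME g. good m c g))"
  define \<psi> where "\<psi> m = (SOME g. good m (C m) g)" for m
  have C: "C 0 = id" "C (Suc m) = C m \<circ> \<psi> m" for m
    by (simp_all add: C_def \<psi>_def)
  have X_inner: "g \<in> conjugations UNIV" if "g \<in> X m" for m g
    using X[of m] that unfolding left_coset_representatives_def by (auto simp: H_eq)
  have inv: "C m \<in> conjugations UNIV \<and> (\<forall>i<m. \<forall>a\<in>A i. C m a = \<phi> a) \<and> good m (C m) (\<psi> m)" for m
  proof (induction m)
    case 0
    have "good 0 id (\<psi> 0)"
      unfolding \<psi>_def C
    proof (rule someI_ex[of "good 0 id"])
      show "\<exists>g. good 0 id g"
        using extend_by_representative[OF \<phi> id_in_conjugations _ X[of 0]] by (auto simp: good_def)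
    qed
    then show ?case unfolding C(1) using id_in_conjugations by blast
  next
    case (Suc m)
    then have inner: "C (Suc m) \<in> conjugations UNIV"
      unfolding C good_def using X_inner by (intro conjugations_comp) auto
    have agree: "\<forall>i<Suc m. \<forall>a\<in>A i. C (Suc m) a = \<phi> a"
      using Suc by (simp add: C good_def)
    have "good (Suc m) (C (Suc m)) (\<psi> (Suc m))"
      unfolding \<psi>_def
    proof (rule someI_ex[of "good (Suc m) (C (Suc m))"])
      have "\<exists>g\<in>X (Suc m). \<forall>i<Suc (Suc m). \<forall>a\<in>A i. C (Suc m) (g a) = \<phi> a"
        by (rule extend_by_representative[OF \<phi> inner _ X]) (use agree in blast)
      then show "\<exists>g. good (Suc m) (C (Suc m)) g" unfolding good_def by blast
    qed
    with inner agree show ?case by blast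
  qed
  have partial: "partial_composition \<psi> m = C m" for m
    by (induction m) (simp_all add: C partial_composition_0 partial_composition_Suc)
  have "has_infinite_product \<psi> \<phi>"
    unfolding has_infinite_product_iff partial
  proof
    fix x
    obtain m where m: "x \<in> span (prod_list ` tuples A m)"
      using tuples_exhaust .
    have "C k x = \<phi> x" if "m \<le> k" for k
    proof (rule endos_agree_on_span[OF inner_endo \<phi> _ m])
      show "C k \<in> conjugations UNIV" using inv[of k] by blast
      fix i a assume "i < m" "a \<in> A i"
      moreover from this that have "i < k" by simp
      ultimately show "C k a = \<phi> a" using inv[of k] by blast
    qed
    then show "\<forall>\<^sub>F k in sequentially. C k x = \<phi> x"
      by (auto simp: eventually_sequentially)
  qed
  moreover have "\<psi> k \<in> X k" for k
    using inv[of k] by (simp add: good_def)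
  ultimately show ?thesis by blast
qed

text \<open>
  Later members of the sequence fix \<open>A i\<close>, so the partial compositions are constant there.
\<close>

lemma infinite_product_on_factor:
  assumes \<psi>: "\<And>k. \<psi> k \<in> H A k" and lim: "has_infinite_product \<psi> \<phi>"
    and a: "i \<le> k" "a \<in> A i"
  shows "\<phi> a = partial_composition \<psi> k (\<psi> k a)"
proof -
  have stable: "partial_composition \<psi> (Suc k + j) a = partial_composition \<psi> (Suc k) a" for j
  proof (induction j)
    case (Suc j)
    have "i < Suc k + j" using a by simp
    then have "\<psi> (Suc k + j) a = a"
      using \<psi>[of "Suc k + j"] a(2) unfolding H_eq by blast
    with Suc show ?case by (simp add: partial_composition_Suc[of _ "Suc (k + j)"])
  qed simp
  obtain m where m: "\<And>m'. m \<le> m' \<Longrightarrow> partial_composition \<psi> m' a = \<phi> a"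
    using lim unfolding has_infinite_product_iff eventually_sequentially by blast
  have "\<phi> a = partial_composition \<psi> (Suc k + m) a"
    using m[of "Suc k + m"] by simp
  then show ?thesis
    unfolding stable by (simp add: partial_composition_Suc)
qed

text \<open>
  By strong induction, the sequences coincide below \<open>k\<close>; cancelling the common injective prefix
  shows that \<open>\<psi> k\<close> and \<open>\<psi>' k\<close> agree on the factors up to \<open>k\<close>, so they represent the same coset.
\<close>

lemma infinite_product_unique:
  assumes X: "\<And>k. left_coset_representatives Inn (H A k) (H A (Suc k)) (X k)"
    and \<psi>: "\<And>k. \<psi> k \<in> X k" "has_infinite_product \<psi> \<phi>"
    and \<psi>': "\<And>k. \<psi>' k \<in> X k" "has_infinite_product \<psi>' \<phi>"
  shows "\<psi> = \<psi>'"
proof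
  have XH: "X k \<subseteq> H A k" for k
    using X unfolding left_coset_representatives_def by blast
  have \<psi>H: "\<psi> k \<in> H A k" "\<psi>' k \<in> H A k" for k
    using XH \<psi>(1) \<psi>'(1) by blast+
  fix k
  show "\<psi> k = \<psi>' k"
  proof (induction k rule: less_induct)
    case (less k)
    let ?P = "partial_composition \<psi> k"
    have P: "?P = partial_composition \<psi>' k"
      by (rule partial_composition_cong) (rule less)
    have "?P \<in> conjugations UNIV"
      using \<psi>H by (intro partial_composition_inner) (simp add: H_eq)
    then have inj: "inj ?P" by (intro endoD(5) inner_endo)
    have eq: "\<psi> k a = \<psi>' k a" if "i \<le> k" "a \<in> A i" for i a
    proof -
      have "?P (\<psi> k a) = ?P (\<psi>' k a)"
        using infinite_product_on_factor[OF \<psi>H(1) \<psi>(2) that]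
          infinite_product_on_factor[OF \<psi>H(2) \<psi>'(2) that] P by simp
      then show ?thesis using inj by (simp add: inj_eq)
    qed
    have "\<psi> k \<in> conjugations UNIV" "\<psi>' k \<in> conjugations UNIV"
      using \<psi>H[of k] by (simp_all add: H_eq)
    then obtain h where h: "h \<in> conjugations UNIV" "h \<circ> \<psi> k = id" "\<psi> k \<circ> h = id"
      using conjugations_inverse by blast
    have "h \<circ> \<psi>' k \<in> H A (Suc k)"
      unfolding H_eq
    proof (intro CollectI conjI allI impI ballI)
      show "h \<circ> \<psi>' k \<in> conjugations UNIV" by (rule conjugations_comp) fact+
      fix i a assume "i < Suc k" "a \<in> A i"
      then have "(h \<circ> \<psi>' k) a = (h \<circ> \<psi> k) a" using eq[of i a] by simp
      then show "(h \<circ> \<psi>' k) a = a" by (simp add: h)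
    qed
    moreover have "\<psi>' k = \<psi> k \<circ> (h \<circ> \<psi>' k)"
      using h(3) by (simp flip: comp_assoc)
    ultimately have "\<psi>' k \<in> \<psi> k <#\<^bsub>Inn\<^esub> H A (Suc k)"
      unfolding in_left_coset_iff by blast
    moreover have "\<psi> k \<in> \<psi> k <#\<^bsub>Inn\<^esub> H A (Suc k)"
      unfolding in_left_coset_iff by (rule bexI[of _ id]) (simp_all add: H_eq id_in_conjugations)
    moreover have "\<exists>!x. x \<in> X k \<and> x \<in> \<psi> k <#\<^bsub>Inn\<^esub> H A (Suc k)"
      using X[of k] \<psi>H(1)[of k] unfolding left_coset_representatives_def by blast
    ultimately show ?case
      using \<psi>(1)[of k] \<psi>'(1)[of k] by blast
  qed
qed

end

theorem theorem4:
  fixes scale :: "'f::field \<Rightarrow> 'a::ring_1 \<Rightarrow> 'a"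
    and A :: "nat \<Rightarrow> 'a set"
    and n :: "nat \<Rightarrow> nat"
    and X :: "nat \<Rightarrow> ('a \<Rightarrow> 'a) set"
    and \<phi> :: "'a \<Rightarrow> 'a"
  assumes "unital_algebra scale"
    and "unital_algebra.countable_dimensional scale"
    and "unital_algebra.locally_matrix scale"
    and "unital_algebra.infinite_tensor_product scale A"
    and "\<And>i. unital_algebra.matrix_subalgebra scale (n i) (A i)"
    and "\<And>k. left_coset_representatives Inn
               (unital_algebra.H scale A k) (unital_algebra.H scale A (Suc k)) (X k)"
    and "\<And>k. id \<in> X k"
    and "\<phi> \<in> unital_algebra.unital_injective_endos scale"
  shows "\<exists>!\<psi>. (\<forall>k. \<psi> k \<in> X k) \<and> has_infinite_product \<psi> \<phi>"
proof -
  interpret matrix_tensor_product scale A n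
    using assms(1,3,4,5) by (simp add: matrix_tensor_product_def matrix_tensor_product_axioms_def)
  show ?thesis
  proof (rule ex_ex1I)
    show "\<exists>\<psi>. (\<forall>k. \<psi> k \<in> X k) \<and> has_infinite_product \<psi> \<phi>"
      by (rule infinite_product_exists[OF assms(8,6)])
    show "\<psi> = \<psi>'" if "(\<forall>k. \<psi> k \<in> X k) \<and> has_infinite_product \<psi> \<phi>"
      and "(\<forall>k. \<psi>' k \<in> X k) \<and> has_infinite_product \<psi>' \<phi>" for \<psi> \<psi>'
      by (rule infinite_product_unique[OF assms(6)]) (use that in auto)
  qed
qed

end
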